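(* Let $A$ be a $*$-algebra over $K$ and let $\mu\in K\setminus\{0\}$. Then the maps $\alpha,\beta\colon\mathrm{Cay}(A,\mu)\to\mathrm{Cay}(A,\mu)$ defined by $$\alpha(x,y)=(x^*,-y)\quad\text{and}\quad \beta(x,y)=(x^*,y)\qquad (x,y\in A)$$ are $A$-involutions of $\mathrm{Cay}(A,\mu)$. Moreover, if $A$ has no zero divisors, then $\alpha$ and $\beta$ are the only $A$-involutions of $\mathrm{Cay}(A,\mu)$.
   Context: All rings and algebras are unital. $K$ is a commutative associative ring; an algebra $A$ over $K$ is not assumed commutative or associative. An involution of $A$ is a $K$-linear map $x\mapsto x^*$ with $(x^* )^*=x$ and $(xy)^*=y^*x^*$ for all $x,y\in A$; a $*$-algebra is an algebra equipped with an involution. For a $*$-algebra $A$ and $\mu\in K\setminus\{0\}$, the Cayley double $\mathrm{Cay}(A,\mu)$ is the $K$-algebra with underlying module $A\oplus A$ and multiplication $(u,v)(x,y)=(ux+\mu y^*v,\ vx^*+yu)$. An $A$-involution of $\mathrm{Cay}(A,\mu)$ is an involution $\gamma$ of $\mathrm{Cay}(A,\mu)$ such that $\gamma(x,0)=(x^*,0)$ for all $x\in A$. *)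

theory Defs
  imports "HOL-Analysis.Product_Vector"
begin

locale unital_algebra = module scal
  for scal :: "'k::comm_ring_1 \<Rightarrow> 'a::ab_group_add \<Rightarrow> 'a" +
  fixes mult :: "'a \<Rightarrow> 'a \<Rightarrow> 'a" and one :: 'a
  assumes mult_add_left: "mult (x + y) z = mult x z + mult y z"
    and mult_add_right: "mult x (y + z) = mult x y + mult x z"
    and mult_scal_left: "mult (scal k x) y = scal k (mult x y)"
    and mult_scal_right: "mult x (scal k y) = scal k (mult x y)"
    and mult_one_left: "mult one x = x"
    and mult_one_right: "mult x one = x"

locale algebra_involution = unital_algebra scal mult one
  for scal :: "'k::comm_ring_1 \<Rightarrow> 'a::ab_group_add \<Rightarrow> 'a"
    and mult :: "'a \<Rightarrow> 'a \<Rightarrow> 'a" and one :: 'a +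
  fixes star :: "'a \<Rightarrow> 'a"
  assumes star_linear: "module_hom scal scal star"
    and star_star: "star (star x) = x"
    and star_mult: "star (mult x y) = mult (star y) (star x)"

abbreviation star_algebra ::
  "('k::comm_ring_1 \<Rightarrow> 'a::ab_group_add \<Rightarrow> 'a) \<Rightarrow> ('a \<Rightarrow> 'a \<Rightarrow> 'a) \<Rightarrow> 'a \<Rightarrow> ('a \<Rightarrow> 'a) \<Rightarrow> bool"
  where "star_algebra \<equiv> algebra_involution"

text \<open>The Cayley double has underlying module \<open>'a \<times> 'a\<close>: its addition is the componentwise one
  of the product type, its scalar action is the componentwise
  \<^const>\<open>module_prod.scale\<close>.\<close>

abbreviation cay_scale ::
  "('k::comm_ring_1 \<Rightarrow> 'a::ab_group_add \<Rightarrow> 'a) \<Rightarrow> 'k \<Rightarrow> 'a \<times> 'a \<Rightarrow> 'a \<times> 'a"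
  where "cay_scale scal \<equiv> module_prod.scale scal scal"

definition cay_mult ::
  "('k::comm_ring_1 \<Rightarrow> 'a::ab_group_add \<Rightarrow> 'a) \<Rightarrow> ('a \<Rightarrow> 'a \<Rightarrow> 'a) \<Rightarrow> ('a \<Rightarrow> 'a) \<Rightarrow> 'k
    \<Rightarrow> 'a \<times> 'a \<Rightarrow> 'a \<times> 'a \<Rightarrow> 'a \<times> 'a"
  where "cay_mult scal mult star \<mu> = (\<lambda>(u, v) (x, y).
    (mult u x + scal \<mu> (mult (star y) v), mult v (star x) + mult y u))"

definition cay_one :: "'a \<Rightarrow> 'a::ab_group_add \<times> 'a"
  where "cay_one one = (one, 0)"

text \<open>Since \<^locale>\<open>algebra_involution\<close> extends \<^locale>\<open>unital_algebra\<close>, the following predicate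
  also asserts that the Cayley double is a unital algebra.\<close>

definition A_involution ::
  "('k::comm_ring_1 \<Rightarrow> 'a::ab_group_add \<Rightarrow> 'a) \<Rightarrow> ('a \<Rightarrow> 'a \<Rightarrow> 'a) \<Rightarrow> 'a \<Rightarrow> ('a \<Rightarrow> 'a) \<Rightarrow> 'k
    \<Rightarrow> ('a \<times> 'a \<Rightarrow> 'a \<times> 'a) \<Rightarrow> bool"
  where "A_involution scal mult one star \<mu> \<gamma> \<longleftrightarrow>
    algebra_involution (cay_scale scal) (cay_mult scal mult star \<mu>) (cay_one one) \<gamma> \<and>
    (\<forall>x. \<gamma> (x, 0) = (star x, 0))"

definition no_zero_divisors :: "('a \<Rightarrow> 'a \<Rightarrow> 'a::ab_group_add) \<Rightarrow> bool"
  where "no_zero_divisors mult \<longleftrightarrow> (\<forall>x y. mult x y = 0 \<longrightarrow> x = 0 \<or> y = 0)"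

end

theory Submission imports Defs begin

text \<open>
  Inside the Cayley double, \<open>A\<close> sits as the first summand, and with \<open>j = (0, 1)\<close> every element
  is \<open>(x, 0) + (0, y)\<close>, where \<open>(0, y) = (y, 0) j = j (y\<^sup>*, 0)\<close>. The maps \<open>(x, y) \<mapsto> (x\<^sup>*, \<plusminus>y)\<close>
  reverse products because interchanging the factors and starring their first components turns
  \<open>ux + \<mu> y\<^sup>*v\<close> into \<open>x\<^sup>*u\<^sup>* + \<mu> v\<^sup>*y\<close>, its star, and merely swaps the summands of \<open>vx\<^sup>* + yu\<close>.
  A sign on the second components occurs twice in the term \<open>\<mu> v\<^sup>*y\<close>, where it cancels, and once
  in each summand of the second component, where it is wanted.

  Conversely, an \<open>A\<close>-involution \<open>\<gamma>\<close> satisfies \<open>\<gamma> (0, y) = \<gamma> j \<gamma> (y, 0) = (a, b) (y\<^sup>*, 0)\<close>, so it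
  is determined by \<open>\<gamma> j = (a, b)\<close>. Applying \<open>\<gamma>\<close> twice to \<open>j\<close> gives \<open>b\<^sup>2 = 1\<close>, hence \<open>b = \<plusminus>1\<close> in
  the absence of zero divisors. Applying \<open>\<gamma>\<close> to \<open>j\<^sup>2 = (\<mu>1, 0)\<close> then gives \<open>a\<^sup>2 + \<mu>1 = \<mu>1\<close>, hence
  \<open>a = 0\<close>.
\<close>

context unital_algebra
begin

lemma mult_zero_left: "mult 0 x = 0"
  using mult_add_left[of 0 0 x] by simp

lemma mult_zero_right: "mult x 0 = 0"
  using mult_add_right[of x 0 0] by simp

lemma mult_minus_left: "mult (- x) y = - mult x y"
  using mult_add_left[of "- x" x y] by (simp add: mult_zero_left eq_neg_iff_add_eq_0)

lemma mult_minus_right: "mult x (- y) = - mult x y"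
  using mult_add_right[of x "- y" y] by (simp add: mult_zero_right eq_neg_iff_add_eq_0)

lemma square_eq_one_imp:
  assumes "no_zero_divisors mult" and "mult b b = one"
  shows "b = one \<or> b = - one"
proof -
  have "mult (b + - one) (b + one) = 0"
    using assms(2)
    by (simp add: mult_add_left mult_add_right mult_minus_left mult_one_left mult_one_right
        del: add_uminus_conv_diff)
  then show ?thesis
    using assms(1) unfolding no_zero_divisors_def
    by (metis add.inverse_inverse eq_neg_iff_add_eq_0)
qed

end

context algebra_involution
begin

lemma star_add: "star (x + y) = star x + star y"
  using star_linear by (rule module_hom.add)

lemma star_scal: "star (scal k x) = scal k (star x)"
  using star_linear by (rule module_hom.scale)

lemma star_zero: "star 0 = 0"
  using star_add[of 0 0] by simp

lemma star_minus: "star (- x) = - star x"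
  using star_add[of "- x" x] by (simp add: star_zero eq_neg_iff_add_eq_0)

lemma star_one: "star one = one"
  using star_mult[of one "star one"] by (simp add: star_star mult_one_left)

lemma module_pair_self: "module_prod scal scal"
  by (intro module_prod.intro module_pair.intro module_axioms)

lemma cay_scale_Pair: "cay_scale scal k (x, y) = (scal k x, scal k y)"
  using module_prod.scale_def[OF module_pair_self] by simp

lemma unital_algebra_cay:
  "unital_algebra (cay_scale scal) (cay_mult scal mult star \<mu>) (cay_one one)"
proof -
  interpret P: module "cay_scale scal"
    by unfold_locales
      (auto simp: cay_scale_Pair scale_right_distrib scale_left_distrib)
  show ?thesis
    by unfold_locales
      (auto simp: cay_mult_def cay_one_def cay_scale_Pair mult_add_left mult_add_right
        mult_scal_left mult_scal_right mult_one_left mult_one_right mult_zero_left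
        mult_zero_right star_add star_scal star_zero star_one scale_right_distrib
        scale_left_commute algebra_simps)
qed

text \<open>
  Identity and negation are both additive, linear and self-inverse, and pass through either
  factor of a product, so one argument covers both signs on the second component.
\<close>

lemma A_involution_star_sign:
  assumes \<gamma>: "\<And>x y. \<gamma> (x, y) = (star x, \<epsilon> y)"
    and \<epsilon>: "\<epsilon> = id \<or> \<epsilon> = uminus"
  shows "A_involution scal mult one star \<mu> \<gamma>"
proof -
  interpret C: unital_algebra "cay_scale scal" "cay_mult scal mult star \<mu>" "cay_one one"
    by (rule unital_algebra_cay)
  have "module_hom (cay_scale scal) (cay_scale scal) \<gamma>"
    using \<epsilon> by unfold_locales (auto simp: \<gamma> cay_scale_Pair star_add star_scal)
  moreover have "\<gamma> (\<gamma> p) = p" for p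
    using \<epsilon> by (cases p) (auto simp: \<gamma> star_star)
  moreover have "\<gamma> (cay_mult scal mult star \<mu> p q) = cay_mult scal mult star \<mu> (\<gamma> q) (\<gamma> p)"
    for p q
    using \<epsilon>
    by (cases p; cases q)
      (auto simp: \<gamma> cay_mult_def star_add star_scal star_mult star_star star_minus
        mult_minus_left mult_minus_right)
  moreover have "\<gamma> (x, 0) = (star x, 0)" for x
    using \<epsilon> by (auto simp: \<gamma>)
  ultimately show ?thesis
    unfolding A_involution_def
    by (auto intro!: algebra_involution.intro C.unital_algebra_axioms
        algebra_involution_axioms.intro)
qed

text \<open>
  Anti-multiplicativity applied to \<open>(0, y) = (y, 0) j\<close> with \<open>j = (0, 1)\<close>: the value at \<open>j\<close>
  fixes the value at every element of the second summand.
\<close>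

lemma A_involution_determined_at_j:
  assumes "A_involution scal mult one star \<mu> \<gamma>" and j: "\<gamma> (0, one) = (a, b)"
  shows "\<gamma> (x, y) = (star x + mult a (star y), mult b y)"
proof -
  interpret C: algebra_involution "cay_scale scal" "cay_mult scal mult star \<mu>" "cay_one one" \<gamma>
    using assms(1) by (simp add: A_involution_def)
  have A: "\<gamma> (x, 0) = (star x, 0)" for x
    using assms(1) by (simp add: A_involution_def)
  have "\<gamma> (0, y) = \<gamma> (cay_mult scal mult star \<mu> (y, 0) (0, one))"
    by (simp add: cay_mult_def mult_zero_left mult_zero_right star_one star_zero mult_one_left)
  also have "\<dots> = cay_mult scal mult star \<mu> (a, b) (star y, 0)"
    by (simp add: C.star_mult A j)
  also have "\<dots> = (mult a (star y), mult b y)"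
    by (simp add: cay_mult_def star_star star_zero mult_zero_left)
  finally have "\<gamma> (0, y) = (mult a (star y), mult b y)" .
  then show ?thesis
    using C.star_add[of "(x, 0)" "(0, y)"] by (simp add: A)
qed

lemma A_involution_cases:
  assumes inv: "A_involution scal mult one star \<mu> \<gamma>" and nzd: "no_zero_divisors mult"
  shows "(\<forall>x y. \<gamma> (x, y) = (star x, y)) \<or> (\<forall>x y. \<gamma> (x, y) = (star x, - y))"
proof -
  interpret C: algebra_involution "cay_scale scal" "cay_mult scal mult star \<mu>" "cay_one one" \<gamma>
    using inv by (simp add: A_involution_def)
  obtain a b where j: "\<gamma> (0, one) = (a, b)"
    by fastforce
  note form = A_involution_determined_at_j[OF inv j]
  have "mult b b = one"
    using C.star_star[of "(0, one)"] by (simp add: j form mult_one_right)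
  then have b: "b = one \<or> b = - one"
    by (rule square_eq_one_imp[OF nzd])
  then have b_norm: "mult (star b) b = one"
    by (auto simp: star_one star_minus mult_minus_left mult_minus_right mult_one_left)
  \<comment> \<open>Both sides of \<open>\<gamma> (j\<^sup>2) = (\<gamma> j)\<^sup>2\<close>, compared in their first components.\<close>
  have "scal \<mu> one = mult a a + scal \<mu> one"
    using C.star_mult[of "(0, one)" "(0, one)"]
    by (simp add: j form cay_mult_def b_norm star_one star_scal star_zero mult_zero_left
        mult_zero_right mult_one_left mult_one_right)
  then have "a = 0"
    using nzd by (auto simp: no_zero_divisors_def)
  then show ?thesis
    using b by (auto simp: form mult_zero_left mult_minus_left mult_one_left)
qed

end

theorem corollary1:
  fixes scal :: "'k::comm_ring_1 \<Rightarrow> 'a::ab_group_add \<Rightarrow> 'a"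
    and mult :: "'a \<Rightarrow> 'a \<Rightarrow> 'a" and one :: 'a and star :: "'a \<Rightarrow> 'a" and \<mu> :: 'k
    and \<alpha> \<beta> :: "'a \<times> 'a \<Rightarrow> 'a \<times> 'a"
  assumes "star_algebra scal mult one star"
    and "\<mu> \<noteq> 0"
    and "\<And>x y. \<alpha> (x, y) = (star x, - y)"
    and "\<And>x y. \<beta> (x, y) = (star x, y)"
  shows "A_involution scal mult one star \<mu> \<alpha> \<and> A_involution scal mult one star \<mu> \<beta> \<and>
    (no_zero_divisors mult \<longrightarrow>
      (\<forall>\<gamma>. A_involution scal mult one star \<mu> \<gamma> \<longrightarrow> \<gamma> = \<alpha> \<or> \<gamma> = \<beta>))"
proof -
  interpret algebra_involution scal mult one star
    by (rule assms(1))
  have "A_involution scal mult one star \<mu> \<alpha>"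
    by (rule A_involution_star_sign[where \<epsilon> = uminus]) (simp_all add: assms(3))
  moreover have "A_involution scal mult one star \<mu> \<beta>"
    by (rule A_involution_star_sign[where \<epsilon> = id]) (simp_all add: assms(4))
  moreover have "\<gamma> = \<alpha> \<or> \<gamma> = \<beta>"
    if "no_zero_divisors mult" and "A_involution scal mult one star \<mu> \<gamma>" for \<gamma>
    using A_involution_cases[OF that(2,1)] by (auto simp: fun_eq_iff assms(3,4))
  ultimately show ?thesis
    by blast
qed

end
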